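(* Let $\mathcal{E}$ be an ellipse with semi-axes $a,b>0$, $M$ any point of the plane and $\theta\in\mathbb{R}$. Let $A=\pi ab$ be the area of $\mathcal{E}$, and let $A_p$, $A_\theta$ be the signed areas of the pedal curve and of the rotated pedal curve $\mathcal{E}_\theta$ of $\mathcal{E}$ with respect to $M$. Then $A_p-A_\theta=A\sin^2\theta$.
   Context: Parametrize $\mathcal{E}$ by $P(t)=(a\cos t,b\sin t)$, $t\in[0,2\pi]$. The pedal curve with respect to $M$ is $t\mapsto Q_p(t)$, where $Q_p(t)$ is the foot of the perpendicular dropped from $M$ onto the tangent line to $\mathcal{E}$ at $P(t)$. The rotated pedal curve $\mathcal{E}_\theta$ is $t\mapsto Q_\theta(t)$, where $Q_\theta(t)$ is the foot of the perpendicular dropped from $M$ onto the line through $P(t)$ whose direction is $P'(t)$ rotated by the angle $\theta$ (counterclockwise). The signed area of a closed parametrized curve $\gamma$ is $\frac12\int_\gamma(x\,dy-y\,dx)$, with orientation given by increasing $t$. *)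

theory Defs
  imports "HOL-Analysis.Analysis"
begin

definition ellipse_param :: "real \<Rightarrow> real \<Rightarrow> real \<Rightarrow> real \<times> real" where
  "ellipse_param a b t = (a * cos t, b * sin t)"

definition line_through :: "real \<times> real \<Rightarrow> real \<times> real \<Rightarrow> (real \<times> real) set" where
  "line_through P d = {P + s *\<^sub>R d | s. True}"

(* A point with the stated property is unique for every set L; it exists for every line. *)
definition foot_of_perp :: "real \<times> real \<Rightarrow> (real \<times> real) set \<Rightarrow> real \<times> real" where
  "foot_of_perp M L = (THE Q. Q \<in> L \<and> (\<forall>X\<in>L. orthogonal (M - Q) (X - Q)))"

(* Positive angles are counterclockwise. *)
definition rotate_vec :: "real \<Rightarrow> real \<times> real \<Rightarrow> real \<times> real" where
  "rotate_vec \<theta> v =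
     (cos \<theta> * fst v - sin \<theta> * snd v, sin \<theta> * fst v + cos \<theta> * snd v)"

definition pedal_curve :: "real \<Rightarrow> real \<Rightarrow> real \<times> real \<Rightarrow> real \<Rightarrow> real \<times> real" where
  "pedal_curve a b M t =
     foot_of_perp M
       (line_through (ellipse_param a b t) (vector_derivative (ellipse_param a b) (at t)))"

definition rotated_pedal_curve ::
    "real \<Rightarrow> real \<Rightarrow> real \<times> real \<Rightarrow> real \<Rightarrow> real \<Rightarrow> real \<times> real" where
  "rotated_pedal_curve a b M \<theta> t =
     foot_of_perp M
       (line_through (ellipse_param a b t)
         (rotate_vec \<theta> (vector_derivative (ellipse_param a b) (at t))))"

definition signed_area :: "real \<Rightarrow> real \<Rightarrow> (real \<Rightarrow> real \<times> real) \<Rightarrow> real" where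
  "signed_area u v \<gamma> =
     (1 / 2) * integral {u..v} (\<lambda>t.
        fst (\<gamma> t) * snd (vector_derivative \<gamma> (at t within {u..v}))
      - snd (\<gamma> t) * fst (vector_derivative \<gamma> (at t within {u..v})))"

end

theory Submission
  imports Defs
begin

text \<open>
  The identity holds for the pedal curves of every closed regular \<open>C\<^sup>2\<close> curve \<open>P\<close> whose tangent
  vector \<open>T\<close> also closes up, with the signed area of \<open>P\<close> in place of \<open>\<pi> a b\<close>; the ellipse enters only
  through the value of that area.

  Write \<open>w = P - M\<close>, let \<open>p = w \<times> T\<close> and \<open>q = w \<bullet> T\<close> be the components of \<open>w\<close> along the normal
  and along the tangent (up to sign and the factor \<open>|T|\<close>), and let \<open>D = T \<bullet> T\<close> and
  \<open>\<kappa> = T \<times> T'\<close>. The foot of the perpendicular is obtained by projecting \<open>w\<close> onto the normal of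
  the rotated line, so that \<open>Q\<^sub>\<theta> - M\<close> is, up to sign, the multiple by
  \<open>(cos \<theta> p + sin \<theta> q) / \<surd>D\<close> of the rotated unit normal. The direction of that normal turns at the
  rate \<open>\<kappa> / D\<close>, the same for all \<open>\<theta>\<close>. The area swept out from \<open>M\<close>, which for a closed curve is
  the signed area (\<open>signed_area_about_point\<close>), is thus given by the polar area formula
  \<open>A\<^sub>\<theta> = 1/2 \<integral> (cos \<theta> p + sin \<theta> q)\<^sup>2 \<kappa> / D\<^sup>2\<close> (\<open>signed_area_rotated_pedal\<close>). Therefore
  \<open>A\<^sub>0 - A\<^sub>\<theta> = 1/2 \<integral> (sin\<^sup>2 \<theta> (p\<^sup>2 - q\<^sup>2) - 2 sin \<theta> cos \<theta> p q) \<kappa> / D\<^sup>2\<close>.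

  Both parts of the integrand are derivatives up to a multiple of twice the area element of \<open>P\<close>:
  \<open>(p\<^sup>2 - q\<^sup>2) \<kappa> / D\<^sup>2 = p - (p q / D)'\<close> and \<open>2 p q \<kappa> / D\<^sup>2 = (p\<^sup>2 / D)'\<close>.
  The derivatives integrate to \<open>0\<close> over a closed curve, and \<open>1/2 \<integral> p\<close> is the signed area of \<open>P\<close>.
\<close>

section \<open>Plane vectors and rotations\<close>

definition cross2 :: "real \<times> real \<Rightarrow> real \<times> real \<Rightarrow> real" where
  "cross2 v w = fst v * snd w - snd v * fst w"

definition quarter_turn :: "real \<times> real \<Rightarrow> real \<times> real" where
  "quarter_turn v = (- snd v, fst v)"

lemma inner_prod_real: "v \<bullet> w = fst v * fst w + snd v * snd w" for v w :: "real \<times> real"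
  by (simp add: inner_prod_def)

lemma bounded_linear_quarter_turn: "bounded_linear quarter_turn"
  unfolding quarter_turn_def
  by (intro bounded_linear_Pair bounded_linear_minus bounded_linear_fst bounded_linear_snd)

lemma bounded_linear_rotate_vec: "bounded_linear (rotate_vec \<theta>)"
  unfolding rotate_vec_def
  by (intro bounded_linear_Pair bounded_linear_sub bounded_linear_add bounded_linear_const_mult
      bounded_linear_fst bounded_linear_snd)

lemma bounded_bilinear_cross2: "bounded_bilinear cross2"
  using bounded_bilinear.comp1[OF bounded_bilinear_inner bounded_linear_quarter_turn]
  by (simp add: quarter_turn_def cross2_def[abs_def] inner_prod_real[abs_def] algebra_simps)

lemmas cross2_has_vector_derivative =
  bounded_bilinear.has_vector_derivative[OF bounded_bilinear_cross2]

lemmas continuous_on_cross2 = bounded_bilinear.continuous_on[OF bounded_bilinear_cross2]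

lemma signed_area_cross2:
  "signed_area u v \<gamma> =
    1 / 2 * integral {u..v} (\<lambda>t. cross2 (\<gamma> t) (vector_derivative \<gamma> (at t within {u..v})))"
  by (simp add: signed_area_def cross2_def)

lemma rotate_vec_zero [simp]: "rotate_vec 0 v = v"
  by (simp add: rotate_vec_def)

lemma inner_rotate_vec [simp]: "rotate_vec \<theta> v \<bullet> rotate_vec \<theta> w = v \<bullet> w"
  unfolding rotate_vec_def inner_prod_real fst_conv snd_conv
  using sin_cos_squared_add[of \<theta>] by algebra

lemma cross2_rotate_vec [simp]: "cross2 (rotate_vec \<theta> v) (rotate_vec \<theta> w) = cross2 v w"
  unfolding rotate_vec_def cross2_def fst_conv snd_conv
  using sin_cos_squared_add[of \<theta>] by algebra

lemma cross2_quarter_turn [simp]: "cross2 (quarter_turn v) (quarter_turn w) = cross2 v w"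
  by (simp add: quarter_turn_def cross2_def)

lemma cross2_rotate_vec_right:
  "cross2 v (rotate_vec \<theta> w) = cos \<theta> * cross2 v w + sin \<theta> * (v \<bullet> w)"
  by (simp add: rotate_vec_def cross2_def inner_prod_real algebra_simps)

section \<open>Feet of perpendiculars\<close>

lemma foot_of_perp_eqI:
  assumes "Q \<in> L" and "\<And>X. X \<in> L \<Longrightarrow> orthogonal (M - Q) (X - Q)"
  shows "foot_of_perp M L = Q"
  unfolding foot_of_perp_def
proof (rule the_equality)
  fix R assume R: "R \<in> L \<and> (\<forall>X\<in>L. orthogonal (M - R) (X - R))"
  have "(M - R) \<bullet> (Q - R) = 0" "(M - Q) \<bullet> (R - Q) = 0"
    using R assms by (auto simp: orthogonal_def)
  then have "(Q - R) \<bullet> (Q - R) = 0"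
    by (simp add: inner_diff inner_commute)
  then show "R = Q" by simp
qed (use assms in auto)

text \<open>
  Projecting \<open>P - M\<close> onto the normal \<open>quarter_turn d\<close>, rather than \<open>M - P\<close> onto \<open>d\<close>, exhibits
  the foot as \<open>M\<close> plus a multiple of a vector that depends on the direction of the line only.
\<close>

lemma foot_of_perp_line:
  assumes "d \<noteq> 0"
  shows "foot_of_perp M (line_through P d) =
    M + (- cross2 (P - M) d / (d \<bullet> d)) *\<^sub>R quarter_turn d"
proof (rule foot_of_perp_eqI)
  define s where "s = - ((P - M) \<bullet> d) / (d \<bullet> d)"
  define Q where "Q = M + (- cross2 (P - M) d / (d \<bullet> d)) *\<^sub>R quarter_turn d"
  have dd: "d \<bullet> d \<noteq> 0" using assms by simp
  have ds: "(d \<bullet> d) * s = - ((P - M) \<bullet> d)" using dd by (simp add: s_def)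
  \<comment> \<open>the decomposition of a vector in the orthogonal basis \<open>d\<close>, \<open>quarter_turn d\<close>\<close>
  have decomp: "(d \<bullet> d) *\<^sub>R w = (w \<bullet> d) *\<^sub>R d - cross2 w d *\<^sub>R quarter_turn d" for w
    by (simp add: prod_eq_iff cross2_def quarter_turn_def inner_prod_real algebra_simps)
  have "(d \<bullet> d) *\<^sub>R (P + s *\<^sub>R d) = (d \<bullet> d) *\<^sub>R M + (d \<bullet> d) *\<^sub>R (P - M) - ((P - M) \<bullet> d) *\<^sub>R d"
    using ds by (simp add: scaleR_right_distrib scaleR_right_diff_distrib)
  also have "\<dots> = (d \<bullet> d) *\<^sub>R Q"
    unfolding decomp[of "P - M"] Q_def using dd by (simp add: algebra_simps)
  finally have Q: "Q = P + s *\<^sub>R d" using dd by simp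
  then show "M + (- cross2 (P - M) d / (d \<bullet> d)) *\<^sub>R quarter_turn d \<in> line_through P d"
    unfolding line_through_def Q_def by blast
  fix X assume "X \<in> line_through P d"
  then obtain r where "X - Q = (r - s) *\<^sub>R d"
    by (auto simp: line_through_def Q algebra_simps)
  then show "orthogonal (M - (M + (- cross2 (P - M) d / (d \<bullet> d)) *\<^sub>R quarter_turn d))
      (X - (M + (- cross2 (P - M) d / (d \<bullet> d)) *\<^sub>R quarter_turn d))"
    unfolding Q_def[symmetric]
    by (simp add: Q_def orthogonal_def quarter_turn_def inner_prod_real)
qed

section \<open>The polar area formula for rotated pedal curves\<close>

text \<open>
  Moving the origin to \<open>M\<close> changes the area integrand by \<open>M \<times> \<gamma>' = (M \<times> \<gamma>)'\<close>, which integrates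
  to \<open>0\<close> over a closed curve.
\<close>

lemma signed_area_about_point:
  assumes "u < v"
    and \<gamma>: "\<And>t. t \<in> {u..v} \<Longrightarrow> (\<gamma> has_vector_derivative \<gamma>' t) (at t within {u..v})"
    and closed: "\<gamma> u = \<gamma> v"
    and I: "((\<lambda>t. cross2 (\<gamma> t - M) (\<gamma>' t)) has_integral I) {u..v}"
  shows "signed_area u v \<gamma> = I / 2"
proof -
  have "((\<lambda>t. cross2 M (\<gamma> t)) has_vector_derivative cross2 M (\<gamma>' t)) (at t within {u..v})"
    if "t \<in> {u..v}" for t
    using cross2_has_vector_derivative[OF has_vector_derivative_const \<gamma>[OF that], of M]
    by (simp add: bounded_bilinear.zero_left[OF bounded_bilinear_cross2])
  then have "((\<lambda>t. cross2 M (\<gamma>' t)) has_integral cross2 M (\<gamma> v) - cross2 M (\<gamma> u)) {u..v}"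
    using \<open>u < v\<close> by (intro fundamental_theorem_of_calculus) auto
  from has_integral_add[OF I this]
  have "((\<lambda>t. cross2 (\<gamma> t) (\<gamma>' t)) has_integral I) {u..v}"
    by (simp add: closed bounded_bilinear.diff_left[OF bounded_bilinear_cross2])
  moreover have "vector_derivative \<gamma> (at t within {u..v}) = \<gamma>' t" if "t \<in> {u..v}" for t
    using \<gamma>[OF that] \<open>u < v\<close> that by (intro vector_derivative_within_closed_interval)
  ultimately have "((\<lambda>t. cross2 (\<gamma> t) (vector_derivative \<gamma> (at t within {u..v})))
      has_integral I) {u..v}"
    by (subst has_integral_cong[where g = "\<lambda>t. cross2 (\<gamma> t) (\<gamma>' t)"]) auto
  then show ?thesis
    unfolding signed_area_cross2 by (simp add: integral_unique)
qed

text \<open>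
  The tangent vectors are required to agree at the endpoints because the pedal curves depend on
  them: otherwise those curves need not be closed.
\<close>

locale closed_regular_curve =
  fixes P T T' :: "real \<Rightarrow> real \<times> real" and u v :: real
  assumes less: "u < v"
    and P: "\<And>t. t \<in> {u..v} \<Longrightarrow> (P has_vector_derivative T t) (at t within {u..v})"
    and T: "\<And>t. t \<in> {u..v} \<Longrightarrow> (T has_vector_derivative T' t) (at t within {u..v})"
    and cont_T': "continuous_on {u..v} T'"
    and regular: "\<And>t. t \<in> {u..v} \<Longrightarrow> T t \<noteq> 0"
    and closed: "P u = P v" "T u = T v"
begin

definition rotated_pedal :: "real \<times> real \<Rightarrow> real \<Rightarrow> real \<Rightarrow> real \<times> real" where
  "rotated_pedal M \<theta> t = foot_of_perp M (line_through (P t) (rotate_vec \<theta> (T t)))"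

lemma cont_P: "continuous_on {u..v} P"
  using P by (rule continuous_on_vector_derivative)

lemma cont_T: "continuous_on {u..v} T"
  using T by (rule continuous_on_vector_derivative)

lemma speed: "t \<in> {u..v} \<Longrightarrow> T t \<bullet> T t \<noteq> 0"
  using regular by simp

text \<open>
  This is \<open>(P - M) \<times> rotate_vec \<theta> T\<close>, expanded so that its dependence on \<open>\<theta>\<close> is explicit: up to
  the factor \<open>|T|\<close>, the signed distance from \<open>M\<close> to the rotated tangent line.
\<close>

definition normal_offset :: "real \<times> real \<Rightarrow> real \<Rightarrow> real \<Rightarrow> real" where
  "normal_offset M \<theta> t = cos \<theta> * cross2 (P t - M) (T t) + sin \<theta> * ((P t - M) \<bullet> T t)"

lemma rotated_pedal_eq:
  assumes "t \<in> {u..v}"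
  shows "rotated_pedal M \<theta> t =
    M + (- normal_offset M \<theta> t / (T t \<bullet> T t)) *\<^sub>R quarter_turn (rotate_vec \<theta> (T t))"
proof -
  have "rotate_vec \<theta> (T t) \<noteq> 0"
    using speed[OF assms] inner_rotate_vec[of \<theta> "T t" "T t"] by (metis inner_zero_left)
  then show ?thesis
    by (simp add: rotated_pedal_def foot_of_perp_line cross2_rotate_vec_right normal_offset_def)
qed

lemma cross_has_derivative:
  assumes "t \<in> {u..v}"
  shows "((\<lambda>t. cross2 (P t - M) (T t)) has_real_derivative cross2 (P t - M) (T' t))
    (at t within {u..v})"
proof -
  have "((\<lambda>t. P t - M) has_vector_derivative T t) (at t within {u..v})"
    using has_vector_derivative_diff[OF P[OF assms] has_vector_derivative_const[of M]] by simp
  from cross2_has_vector_derivative[OF this T[OF assms]] show ?thesis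
    by (simp add: has_real_derivative_iff_has_vector_derivative cross2_def)
qed

lemma inner_has_derivative:
  assumes "t \<in> {u..v}"
  shows "((\<lambda>t. (P t - M) \<bullet> T t) has_real_derivative T t \<bullet> T t + (P t - M) \<bullet> T' t)
    (at t within {u..v})"
proof -
  have "((\<lambda>t. P t - M) has_vector_derivative T t) (at t within {u..v})"
    using has_vector_derivative_diff[OF P[OF assms] has_vector_derivative_const[of M]] by simp
  from bounded_bilinear.has_vector_derivative[OF bounded_bilinear_inner this T[OF assms]]
  show ?thesis
    by (simp add: has_real_derivative_iff_has_vector_derivative add.commute)
qed

lemma speed_has_derivative:
  assumes "t \<in> {u..v}"
  shows "((\<lambda>t. T t \<bullet> T t) has_real_derivative 2 * (T t \<bullet> T' t)) (at t within {u..v})"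
  using bounded_bilinear.has_vector_derivative[OF bounded_bilinear_inner T[OF assms] T[OF assms]]
  by (simp add: has_real_derivative_iff_has_vector_derivative inner_commute)

text \<open>
  Differentiating \<open>Q - M = k n\<close>, with a scalar \<open>k\<close> and \<open>n\<close> the rotated normal, gives
  \<open>(Q - M) \<times> Q' = k\<^sup>2 (n \<times> n')\<close>, since \<open>k'\<close> multiplies \<open>n \<times> n = 0\<close>. A rotation by a constant angle
  preserves \<open>n \<times> n'\<close>, so \<open>\<theta>\<close> survives only in \<open>k\<close>.
\<close>

lemma signed_area_rotated_pedal:
  "signed_area u v (rotated_pedal M \<theta>) =
    1 / 2 * integral {u..v} (\<lambda>t. (normal_offset M \<theta> t / (T t \<bullet> T t))\<^sup>2 * cross2 (T t) (T' t))"
    (is "_ = 1 / 2 * integral _ ?f")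
proof -
  define k where "k t = - normal_offset M \<theta> t / (T t \<bullet> T t)" for t
  define k' where "k' t =
    - ((cos \<theta> * cross2 (P t - M) (T' t) + sin \<theta> * (T t \<bullet> T t + (P t - M) \<bullet> T' t)) * (T t \<bullet> T t)
       - normal_offset M \<theta> t * (2 * (T t \<bullet> T' t))) / (T t \<bullet> T t)\<^sup>2" for t
  define n where "n t = quarter_turn (rotate_vec \<theta> (T t))" for t
  define n' where "n' t = quarter_turn (rotate_vec \<theta> (T' t))" for t
  let ?g = "\<lambda>t. k' t *\<^sub>R n t + k t *\<^sub>R n' t"
  have k: "(k has_real_derivative k' t) (at t within {u..v})" if "t \<in> {u..v}" for t
    unfolding k_def[abs_def] k'_def normal_offset_def
    by (rule derivative_eq_intros cross_has_derivative[OF that] inner_has_derivative[OF that]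
        speed_has_derivative[OF that] refl speed[OF that])+
      (simp add: power2_eq_square minus_divide_left[symmetric] algebra_simps)
  have n: "(n has_vector_derivative n' t) (at t within {u..v})" if "t \<in> {u..v}" for t
    unfolding n_def[abs_def] n'_def
    by (intro bounded_linear.has_vector_derivative[OF bounded_linear_quarter_turn]
        bounded_linear.has_vector_derivative[OF bounded_linear_rotate_vec] T that)
  have eq: "rotated_pedal M \<theta> t = M + k t *\<^sub>R n t" if "t \<in> {u..v}" for t
    using rotated_pedal_eq[OF that] by (simp add: k_def n_def)
  have deriv: "(rotated_pedal M \<theta> has_vector_derivative ?g t) (at t within {u..v})"
    if t: "t \<in> {u..v}" for t
  proof (rule has_vector_derivative_transform[OF t eq])
    have "((\<lambda>t. M + k t *\<^sub>R n t) has_vector_derivative 0 + (k t *\<^sub>R n' t + k' t *\<^sub>R n t))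
        (at t within {u..v})"
      by (intro has_vector_derivative_add has_vector_derivative_const
          has_vector_derivative_scaleR k n t)
    then show "((\<lambda>t. M + k t *\<^sub>R n t) has_vector_derivative ?g t) (at t within {u..v})"
      by (simp add: add.commute)
  qed
  have "continuous_on {u..v} ?f"
    unfolding normal_offset_def using speed
    by (intro continuous_intros continuous_on_cross2 cont_P cont_T cont_T') auto
  then have "(?f has_integral integral {u..v} ?f) {u..v}"
    by (intro integrable_integral integrable_continuous_real)
  moreover have "cross2 (rotated_pedal M \<theta> t - M) (?g t) = ?f t" if "t \<in> {u..v}" for t
  proof -
    have "cross2 (rotated_pedal M \<theta> t - M) (?g t) = (k t)\<^sup>2 * cross2 (n t) (n' t)"
      by (simp add: eq[OF that] cross2_def power2_eq_square algebra_simps)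
    then show ?thesis by (simp add: k_def n_def n'_def)
  qed
  ultimately have "((\<lambda>t. cross2 (rotated_pedal M \<theta> t - M) (?g t))
      has_integral integral {u..v} ?f) {u..v}"
    by (subst has_integral_cong[where g = ?f]) auto
  moreover have "rotated_pedal M \<theta> u = rotated_pedal M \<theta> v"
    by (simp add: rotated_pedal_def closed)
  ultimately show ?thesis
    using signed_area_about_point[OF less deriv] by simp
qed

section \<open>The difference of the areas\<close>

theorem signed_area_pedal_minus_rotated_pedal:
  "signed_area u v (rotated_pedal M 0) - signed_area u v (rotated_pedal M \<theta>) =
    signed_area u v P * (sin \<theta>)\<^sup>2"
proof -
  define D where "D t = T t \<bullet> T t" for t
  define p where "p t = cross2 (P t - M) (T t)" for t
  define q where "q t = (P t - M) \<bullet> T t" for t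
  define \<kappa> where "\<kappa> t = cross2 (T t) (T' t)" for t
  define f where "f \<phi> t = (normal_offset M \<phi> t / D t)\<^sup>2 * \<kappa> t" for \<phi> t
  define H where "H t = (sin \<theta>)\<^sup>2 * (p t * q t / D t) + sin \<theta> * cos \<theta> * ((p t)\<^sup>2 / D t)" for t
  have cont_f: "continuous_on {u..v} (f \<phi>)" for \<phi>
    unfolding f_def normal_offset_def D_def \<kappa>_def using speed
    by (intro continuous_intros continuous_on_cross2 cont_P cont_T cont_T') auto
  have "continuous_on {u..v} p"
    unfolding p_def by (intro continuous_intros continuous_on_cross2 cont_P cont_T)
  then have int_p: "(p has_integral integral {u..v} p) {u..v}"
    by (intro integrable_integral integrable_continuous_real)
  have area: "signed_area u v P = integral {u..v} p / 2"
    using less P closed(1) int_p[unfolded p_def] unfolding p_def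
    by (rule signed_area_about_point)
  \<comment> \<open>The boundary values of \<open>H\<close> agree, so this makes \<open>sin\<^sup>2 \<theta> \<integral> p\<close> equal to the integral
    of \<open>f 0 - f \<theta>\<close>, which is twice the difference of the areas.\<close>
  have "(H has_vector_derivative (sin \<theta>)\<^sup>2 * p t - (f 0 t - f \<theta> t)) (at t within {u..v})"
    if t: "t \<in> {u..v}" for t
  proof -
    define p' where "p' = cross2 (P t - M) (T' t)"
    define q' where "q' = D t + (P t - M) \<bullet> T' t"
    define D' where "D' = 2 * (T t \<bullet> T' t)"
    have D: "D t \<noteq> 0" using speed[OF t] by (simp add: D_def)
    have "(p has_real_derivative p') (at t within {u..v})"
      "(q has_real_derivative q') (at t within {u..v})"
      "(D has_real_derivative D') (at t within {u..v})"
      using cross_has_derivative[OF t] inner_has_derivative[OF t] speed_has_derivative[OF t]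
      by (simp_all add: p_def[abs_def] q_def[abs_def] D_def[abs_def] p'_def q'_def D'_def)
    then have dH: "(H has_real_derivative
        (sin \<theta>)\<^sup>2 * (((p' * q t + p t * q') * D t - p t * q t * D') / (D t)\<^sup>2)
        + sin \<theta> * cos \<theta> * ((2 * p t * p' * D t - (p t)\<^sup>2 * D') / (D t)\<^sup>2)) (at t within {u..v})"
      unfolding H_def[abs_def] using D
      by (auto intro!: derivative_eq_intros simp: power2_eq_square algebra_simps)
    \<comment> \<open>The \<open>p'\<close>, \<open>q'\<close> and \<open>D'\<close> contain inner and cross products of \<open>T'\<close> with \<open>P - M\<close> and \<open>T\<close>;
      the Lagrange-type identities of the plane reduce these to \<open>\<kappa>\<close> alone.\<close>
    have num_pq: "(p' * q t + p t * q') * D t - p t * q t * D' = p t * (D t)\<^sup>2 - ((p t)\<^sup>2 - (q t)\<^sup>2) * \<kappa> t"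
      and num_pp: "2 * p t * p' * D t - (p t)\<^sup>2 * D' = 2 * p t * q t * \<kappa> t"
      by (simp_all add: p'_def q'_def D'_def p_def q_def D_def \<kappa>_def cross2_def inner_prod_real
          power2_eq_square algebra_simps)
    have diff_f: "f 0 t - f \<theta> t =
        ((sin \<theta>)\<^sup>2 * ((p t)\<^sup>2 - (q t)\<^sup>2) - 2 * sin \<theta> * cos \<theta> * p t * q t) * \<kappa> t / (D t)\<^sup>2"
    proof -
      have "f 0 t - f \<theta> t = ((p t)\<^sup>2 - (cos \<theta> * p t + sin \<theta> * q t)\<^sup>2) * \<kappa> t / (D t)\<^sup>2"
        by (simp add: f_def normal_offset_def p_def q_def power_divide diff_divide_distrib left_diff_distrib)
      also have "(p t)\<^sup>2 - (cos \<theta> * p t + sin \<theta> * q t)\<^sup>2 =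
          (sin \<theta>)\<^sup>2 * ((p t)\<^sup>2 - (q t)\<^sup>2) - 2 * sin \<theta> * cos \<theta> * p t * q t"
        by (simp add: power2_sum power_mult_distrib cos_squared_eq algebra_simps)
      finally show ?thesis .
    qed
    have "(sin \<theta>)\<^sup>2 * ((p t * (D t)\<^sup>2 - ((p t)\<^sup>2 - (q t)\<^sup>2) * \<kappa> t) / (D t)\<^sup>2)
        + sin \<theta> * cos \<theta> * (2 * p t * q t * \<kappa> t / (D t)\<^sup>2) =
        (sin \<theta>)\<^sup>2 * p t - (f 0 t - f \<theta> t)"
      using D by (simp add: diff_f diff_divide_distrib add_divide_distrib algebra_simps)
    with dH show ?thesis
      unfolding num_pq num_pp by (simp only: has_real_derivative_iff_has_vector_derivative)
  qed
  then have "((\<lambda>t. (sin \<theta>)\<^sup>2 * p t - (f 0 t - f \<theta> t)) has_integral H v - H u) {u..v}"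
    using less by (intro fundamental_theorem_of_calculus) auto
  then have "((\<lambda>t. (sin \<theta>)\<^sup>2 * p t - (f 0 t - f \<theta> t)) has_integral 0) {u..v}"
    by (simp add: H_def p_def q_def D_def closed)
  moreover have "((\<lambda>t. (sin \<theta>)\<^sup>2 * p t - (f 0 t - f \<theta> t)) has_integral
      (sin \<theta>)\<^sup>2 * integral {u..v} p - (integral {u..v} (f 0) - integral {u..v} (f \<theta>))) {u..v}"
    by (intro has_integral_diff has_integral_mult_right int_p integrable_integral
        integrable_continuous_real cont_f)
  ultimately have "0 = (sin \<theta>)\<^sup>2 * integral {u..v} p -
      (integral {u..v} (f 0) - integral {u..v} (f \<theta>))"
    by (rule has_integral_unique)
  moreover have "signed_area u v (rotated_pedal M \<phi>) = integral {u..v} (f \<phi>) / 2" for \<phi>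
    using signed_area_rotated_pedal[of M \<phi>] by (simp add: f_def[abs_def] D_def \<kappa>_def)
  ultimately show ?thesis
    by (simp add: area algebra_simps)
qed

end

section \<open>The ellipse\<close>

lemma ellipse_param_has_vector_derivative:
  "(ellipse_param a b has_vector_derivative (- a * sin t, b * cos t)) (at t within S)"
  unfolding ellipse_param_def[abs_def]
  by (rule has_vector_derivative_Pair)
    (auto intro!: derivative_eq_intros simp: has_real_derivative_iff_has_vector_derivative[symmetric])

lemma signed_area_ellipse: "signed_area 0 (2 * pi) (ellipse_param a b) = pi * a * b"
proof -
  have "cross2 (ellipse_param a b t - 0) (- a * sin t, b * cos t) = a * b" for t
    unfolding cross2_def ellipse_param_def diff_0_right fst_conv snd_conv
    using sin_cos_squared_add[of t] by algebra
  then have "((\<lambda>t. cross2 (ellipse_param a b t - 0) (- a * sin t, b * cos t)) has_integral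
      2 * pi * (a * b)) {0..2 * pi}"
    using has_integral_const_real[of "a * b" 0 "2 * pi"] by simp
  moreover have "ellipse_param a b 0 = ellipse_param a b (2 * pi)"
    by (simp add: ellipse_param_def)
  ultimately show ?thesis
    using signed_area_about_point[OF _ ellipse_param_has_vector_derivative, of 0 "2 * pi" a b 0]
    by fastforce
qed

theorem corollary5:
  fixes a b \<theta> A A_p A_\<theta> :: real and M :: "real \<times> real"
  assumes "a > 0" and "b > 0"
    and "A = pi * a * b"
    and "A_p = signed_area 0 (2 * pi) (pedal_curve a b M)"
    and "A_\<theta> = signed_area 0 (2 * pi) (rotated_pedal_curve a b M \<theta>)"
  shows "A_p - A_\<theta> = A * (sin \<theta>)\<^sup>2"
proof -
  interpret closed_regular_curve "ellipse_param a b" "\<lambda>t. (- a * sin t, b * cos t)"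
    "\<lambda>t. (- a * cos t, - b * sin t)" 0 "2 * pi"
  proof
    show "((\<lambda>t. (- a * sin t, b * cos t)) has_vector_derivative (- a * cos t, - b * sin t))
        (at t within {0..2 * pi})" for t
      by (rule has_vector_derivative_Pair)
        (auto intro!: derivative_eq_intros
          simp: has_real_derivative_iff_has_vector_derivative[symmetric])
    show "(- a * sin t, b * cos t) \<noteq> 0" for t
      using assms(1,2) sin_cos_squared_add[of t] by (auto simp: zero_prod_def simp del: sin_cos_squared_add)
    show "continuous_on {0..2 * pi} (\<lambda>t. (- a * cos t, - b * sin t))"
      by (intro continuous_intros)
    show "(ellipse_param a b has_vector_derivative (- a * sin t, b * cos t))
        (at t within {0..2 * pi})" for t
      by (rule ellipse_param_has_vector_derivative)
  qed (simp_all add: ellipse_param_def)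
  have T: "vector_derivative (ellipse_param a b) (at t) = (- a * sin t, b * cos t)" for t
    by (rule vector_derivative_at) (rule ellipse_param_has_vector_derivative)
  have "pedal_curve a b M = rotated_pedal M 0"
    "rotated_pedal_curve a b M \<theta> = rotated_pedal M \<theta>"
    by (simp_all only: fun_eq_iff pedal_curve_def rotated_pedal_curve_def rotated_pedal_def T
        rotate_vec_zero simp_thms)
  then show ?thesis
    using signed_area_pedal_minus_rotated_pedal[of M \<theta>] assms(3-5) signed_area_ellipse by simp
qed

end
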